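(* Let $K\subset\mathbb R^2$ be a convex body which has an equipotential circle $\mathcal B$ with centre $O$ in its interior. Then $K$ is centrally symmetric with centre of symmetry $O$. Moreover, if no chord of $K$ which is tangent to $\mathcal B$ subtends an angle $\pi/2$ from $O$ (i.e. $\measuredangle AOB\neq \pi/2$ for every chord $AB$ of $K$ tangent to $\mathcal B$), then $K$ is a disc.
   Context: A convex body is a compact convex set with nonempty interior. A chord of $K$ is a segment with both endpoints on $\partial K$. Given a convex body $K\subset\mathbb R^2$, a circle $\Omega\subset \operatorname{int} K$ (of positive radius) is an equipotential circle of $K$ if there is a constant $\lambda$ such that for every tangent line of $\Omega$, with contact point $P$ and cutting $K$ in the chord $AB$, one has $|AP|\cdot|PB|=\lambda$. *)

theory Defs
  imports "HOL-Analysis.Analysis"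
begin

definition convex_body :: "'a::euclidean_space set \<Rightarrow> bool" where
  "convex_body K \<longleftrightarrow> compact K \<and> convex K \<and> interior K \<noteq> {}"

definition chord :: "'a::euclidean_space set \<Rightarrow> 'a \<Rightarrow> 'a \<Rightarrow> bool" where
  "chord K A B \<longleftrightarrow> A \<in> frontier K \<and> B \<in> frontier K \<and> A \<noteq> B"

definition cuts_in_chord ::
    "'a::euclidean_space set \<Rightarrow> 'a set \<Rightarrow> 'a \<Rightarrow> 'a \<Rightarrow> bool" where
  "cuts_in_chord L K A B \<longleftrightarrow> chord K A B \<and> L \<inter> K = closed_segment A B"

text \<open>The tangent line at the point \<open>P\<close> of the circle with centre \<open>c\<close>
  passing through \<open>P\<close>. It is a line only when \<open>P \<noteq> c\<close>, that is, when
  the circle has positive radius.\<close>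

definition tangent_line :: "real^2 \<Rightarrow> real^2 \<Rightarrow> (real^2) set" where
  "tangent_line c P = {X. (X - P) \<bullet> (P - c) = 0}"

definition tangent_chord :: "(real^2) set \<Rightarrow> real^2 \<Rightarrow> real \<Rightarrow> real^2 \<Rightarrow> real^2 \<Rightarrow> bool" where
  "tangent_chord K c r A B \<longleftrightarrow>
     (\<exists>P\<in>sphere c r. cuts_in_chord (tangent_line c P) K A B)"

definition equipotential_circle :: "(real^2) set \<Rightarrow> real^2 \<Rightarrow> real \<Rightarrow> bool" where
  "equipotential_circle K c r \<longleftrightarrow>
     r > 0 \<and> sphere c r \<subseteq> interior K \<and>
     (\<exists>l. \<forall>P\<in>sphere c r. \<forall>A B. cuts_in_chord (tangent_line c P) K A B \<longrightarrow>
            dist A P * dist P B = l)"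

definition centrally_symmetric :: "'a::real_vector set \<Rightarrow> 'a \<Rightarrow> bool" where
  "centrally_symmetric K c \<longleftrightarrow> (\<lambda>x. 2 *\<^sub>R c - x) ` K = K"

text \<open>The unoriented angle at the vertex \<open>Q\<close>, in \<open>[0, \<pi>]\<close>. Division by zero makes
  it \<open>\<pi>/2\<close> when \<open>A = Q\<close> or \<open>B = Q\<close>; this does not occur when \<open>Q\<close> is an interior
  point of \<open>K\<close> and \<open>A\<close>, \<open>B\<close> lie on its boundary.\<close>

definition angle :: "'a::real_inner \<Rightarrow> 'a \<Rightarrow> 'a \<Rightarrow> real" where
  "angle A Q B = arccos (((A - Q) \<bullet> (B - Q)) / (norm (A - Q) * norm (B - Q)))"

definition disc :: "(real^2) set \<Rightarrow> bool" where
  "disc K \<longleftrightarrow> (\<exists>c r. r > 0 \<and> K = cball c r)"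

end

theory Submission
  imports Defs
begin

text \<open>From the contact point with angle \<open>t\<close> follow the tangent ray to the boundary, and from
  there take the other tangent to the circle, with contact angle \<open>S t = t + 2 * h t\<close>. The
  equipotential condition says that \<open>tan (h t) * tan (h (S t))\<close> is a constant \<open>\<mu>\<close>; hence \<open>h\<close> is
  invariant under \<open>S \<circ> S\<close>, and each orbit of \<open>S \<circ> S\<close> is an arithmetic progression. Convexity of
  \<open>K\<close> makes \<open>S\<close> increasing, so these progressions have a common difference, namely the rotation
  number, and \<open>h t + h (S t)\<close> is constant. If \<open>\<mu> = 1\<close>, this constant is a right angle
  and \<open>S \<circ> S\<close> is the half turn, which gives the central symmetry. Otherwise the sum and the
  product of \<open>tan (h t)\<close> and \<open>tan (h (S t))\<close> are both constant, so \<open>h\<close> takes at most two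
  values; it is then constant by monotonicity of \<open>S\<close>, and \<open>K\<close> is a disc.\<close>

subsection \<open>Dynamics of the tangent map\<close>

text \<open>No continuity of \<open>h\<close> is assumed; monotonicity of the step takes its
  place.\<close>

locale tangent_dynamics =
  fixes h :: "real \<Rightarrow> real" and \<mu> :: real
  assumes h_pos: "0 < h t" and h_less: "h t < pi / 2"
    and h_periodic: "h (t + 2 * pi) = h t"
    and tan_step: "tan (h t) * tan (h (t + 2 * h t)) = \<mu>"
    and step_mono: "s \<le> t \<Longrightarrow> s + 2 * h s \<le> t + 2 * h t"
begin

definition S where "S t = t + 2 * h t"

text \<open>For a body this is the angle at the centre between the ends of the chord touching the
  circle at angle \<open>S t\<close>.\<close>

definition H where "H t = h t + h (S t)"

lemma tan_pos: "tan (h t) > 0"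
  using h_pos h_less by (simp add: tan_gt_zero)

lemma arctan_tan_h: "arctan (tan (h t)) = h t"
  using h_pos[of t] h_less[of t] by (intro arctan_tan) auto

lemma h_eqI: "tan (h s) = tan (h t) \<Longrightarrow> h s = h t"
  by (metis arctan_tan_h)

lemma h_S_S: "h (S (S t)) = h t"
proof (rule h_eqI)
  have "tan (h (S t)) * tan (h (S (S t))) = tan (h (S t)) * tan (h t)"
    using tan_step[of t] tan_step[of "S t"] by (simp add: S_def mult.commute)
  then show "tan (h (S (S t))) = tan (h t)"
    using tan_pos[of "S t"] by simp
qed

lemma S_S: "S (S t) = t + 2 * H t"
  by (simp add: S_def H_def)

lemma H_S_S: "H (S (S t)) = H t"
  unfolding H_def h_S_S ..

lemma S_S_iter: "((\<lambda>u. S (S u)) ^^ n) t = t + 2 * real n * H t \<and> H (((\<lambda>u. S (S u)) ^^ n) t) = H t"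
proof (induction n)
  case (Suc n)
  define u where "u = ((\<lambda>u. S (S u)) ^^ n) t"
  have step: "((\<lambda>u. S (S u)) ^^ Suc n) t = S (S u)" by (simp add: u_def)
  have "u = t + 2 * real n * H t" "H u = H t" using Suc unfolding u_def by blast+
  then show ?case unfolding step H_S_S using S_S[of u] by (simp add: algebra_simps)
qed auto

lemma S_mono: "s \<le> t \<Longrightarrow> S s \<le> S t"
  unfolding S_def by (rule step_mono)

lemma S_S_iter_mono: "s \<le> t \<Longrightarrow> ((\<lambda>u. S (S u)) ^^ n) s \<le> ((\<lambda>u. S (S u)) ^^ n) t"
proof (induction n)
  case (Suc n)
  then have "S (S (((\<lambda>u. S (S u)) ^^ n) s)) \<le> S (S (((\<lambda>u. S (S u)) ^^ n) t))"
    by (blast intro: S_mono)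
  then show ?case by simp
qed auto

lemma h_periodic_nat: "h (t + 2 * pi * real n) = h t"
proof (induction n)
  case (Suc n)
  then show ?case using h_periodic[of "t + 2 * pi * real n"] by (simp add: algebra_simps)
qed auto

lemma H_periodic_nat: "H (t + 2 * pi * real n) = H t"
proof -
  have "S (t + 2 * pi * real n) = S t + 2 * pi * real n"
    by (simp add: S_def h_periodic_nat)
  then show ?thesis by (simp add: H_def h_periodic_nat)
qed

lemma shift_beyond: "\<exists>n. s \<le> t + 2 * pi * real n"
proof -
  obtain n where "(s - t) / (2 * pi) \<le> real n" using real_arch_simple by blast
  then have "s \<le> t + 2 * pi * real n" by (simp add: field_simps)
  then show ?thesis ..
qed

text \<open>If \<open>H t < H s\<close>, the orbit of \<open>s\<close> under \<open>S\<close>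
  applied twice advances by larger steps and overtakes the orbit of a translate of \<open>t\<close>
  by whole turns that starts at or ahead of \<open>s\<close>. A monotone map forbids this.\<close>

lemma H_le: "H s \<le> H t"
proof (rule ccontr)
  assume "\<not> H s \<le> H t"
  then have less: "H t < H s" by simp
  obtain k where k: "s \<le> t + 2 * pi * real k" using shift_beyond by blast
  define t' where "t' = t + 2 * pi * real k"
  have "H t' = H t" "s \<le> t'" using k H_periodic_nat by (auto simp: t'_def)
  obtain n where n: "(t' - s) / (2 * (H s - H t)) < real n" using reals_Archimedean2 by blast
  have "s + 2 * real n * H s \<le> t' + 2 * real n * H t"
    using S_S_iter_mono[OF \<open>s \<le> t'\<close>, of n] S_S_iter[of n s] S_S_iter[of n t'] \<open>H t' = H t\<close> by simp
  with n less show False by (simp add: field_simps)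
qed

lemma H_const: "H s = H t"
  using H_le by (simp add: antisym)

section \<open>Consequences of the constant angle sum\<close>

lemma cos_H: "cos (H t) = cos (h t) * cos (h (S t)) * (1 - \<mu>)"
proof -
  have "cos (h t) > 0" "cos (h (S t)) > 0"
    using h_pos h_less by (auto intro: cos_gt_zero)
  then show ?thesis
    using tan_step[of t] by (simp add: H_def S_def cos_add tan_def field_simps)
qed

lemma sin_H: "sin (H t) = cos (h t) * cos (h (S t)) * (tan (h t) + tan (h (S t)))"
proof -
  have "cos (h t) > 0" "cos (h (S t)) > 0"
    using h_pos h_less by (auto intro: cos_gt_zero)
  then show ?thesis
    by (simp add: H_def sin_add tan_def field_simps)
qed

lemma H_eq_half_pi:
  assumes "\<mu> = 1" shows "h t + h (S t) = pi / 2"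
proof -
  have "cos (H t) = 0" using cos_H assms by simp
  moreover have "0 \<le> H t" "H t \<le> pi" using h_pos[of t] h_less[of t] h_pos[of "S t"] h_less[of "S t"] by (auto simp: H_def)
  ultimately show ?thesis using cos_inj_pi[of "H t" "pi / 2"] by (simp add: H_def)
qed

lemma h_plus_pi:
  assumes "\<mu> = 1" shows "h (t + pi) = h t"
proof -
  have "S (S t) = t + pi" unfolding S_S H_def H_eq_half_pi[OF assms] by simp
  then show ?thesis using h_S_S[of t] by simp
qed

text \<open>With \<open>H\<close> constant, the tangent addition formula makes
  \<open>tan (h u) + \<mu> / tan (h u)\<close> independent of \<open>u\<close>, so every
  \<open>tan (h u)\<close> is a root of one fixed quadratic.\<close>

lemma h_two_values:
  assumes "\<mu> \<noteq> 1" "h s \<noteq> h t" shows "h u = h s \<or> h u = h t"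
proof -
  have pos: "cos (h u) > 0" "tan (h u) > 0" for u
    using h_pos h_less tan_pos by (auto intro: cos_gt_zero)
  have eq: "cos (H t) * (tan (h u) + \<mu> / tan (h u)) = (1 - \<mu>) * sin (H t)" for u
  proof -
    have "\<mu> / tan (h u) = tan (h (S u))"
      using tan_step[of u] pos[of u] by (simp add: S_def field_simps)
    then show ?thesis using cos_H[of u] sin_H[of u] H_const[of u t] by simp
  qed
  have "cos (H t) \<noteq> 0" using cos_H[of t] assms(1) pos(1)[of t] pos(1)[of "S t"] by simp
  then have sum: "tan (h u) + \<mu> / tan (h u) = tan (h v) + \<mu> / tan (h v)" for u v
    using eq[of u] eq[of v] by (metis mult_left_cancel)
  have alt: "tan (h u) = tan (h v) \<or> tan (h u) * tan (h v) = \<mu>" for u v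
  proof -
    have "(tan (h u) - tan (h v)) * (tan (h u) * tan (h v) - \<mu>) = 0"
      using sum[of u v] pos[of u] pos[of v] by (simp add: field_simps)
    then show ?thesis by simp
  qed
  have "tan (h s) \<noteq> tan (h t)" using assms(2) h_eqI by blast
  then have "tan (h u) = tan (h s) \<or> tan (h u) = tan (h t)"
    using alt[of u s] alt[of u t] alt[of s t] pos(2)[of u] pos(2)[of s] by (metis mult.commute mult_left_cancel less_irrefl)
  then show ?thesis using h_eqI by blast
qed

text \<open>Monotonicity of \<open>S\<close> forbids \<open>h\<close> to jump downwards, and periodicity
  excludes a function whose only jumps are upwards.\<close>

lemma h_const:
  assumes "\<mu> \<noteq> 1" shows "h s = h t"
proof -
  have "\<not> h t < h s" for s t
  proof
    assume less: "h t < h s"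
    obtain k where k: "s \<le> t + 2 * pi * real k" using shift_beyond by blast
    define t' where "t' = t + 2 * pi * real k"
    have t': "h t' = h t" "s \<le> t'" using k h_periodic_nat by (auto simp: t'_def)
    obtain n where n: "(t' - s) / (2 * (h s - h t)) < real n" using reals_Archimedean2 by blast
    have "(t' - s) / (2 * (h s - h t)) \<ge> 0" using t' less by simp
    with n have n0: "real n > 0" by linarith
    \<comment> \<open>The interval from \<open>s\<close> to \<open>t'\<close> is cut into
      \<open>n\<close> equal pieces, each shorter than twice the drop
      \<open>h s - h t\<close>.\<close>
    define d where "d = (t' - s) / real n"
    have d: "0 \<le> d" "d < 2 * (h s - h t)"
      using n n0 less t' by (auto simp: d_def field_simps)
    have "h (s + real i * d) = h s" for i
    proof (induction i)
      case (Suc i)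
      let ?u = "s + real i * d"
      \<comment> \<open>Falling from \<open>h s\<close> to \<open>h t\<close> across one piece would
        make \<open>S\<close> decrease.\<close>
      have "?u + 2 * h ?u \<le> (?u + d) + 2 * h (?u + d)" using d by (intro step_mono) auto
      then have "h (?u + d) \<noteq> h t" using Suc d by auto
      then have "h (?u + d) = h s" using h_two_values[OF assms, of s t "?u + d"] less by auto
      then show ?case by (simp add: algebra_simps)
    qed auto
    from this[of n] have "h t' = h s" using n0 by (simp add: d_def)
    with t' less show False by simp
  qed
  then show ?thesis by (meson linorder_neqE)
qed

end

subsection \<open>Plane geometry\<close>

definition unit_vec :: "real \<Rightarrow> real^2" where
  "unit_vec t = vector [cos t, sin t]"

lemma inner_unit_vec: "unit_vec s \<bullet> unit_vec t = cos (s - t)"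
  by (simp add: unit_vec_def inner_vec_def sum_2 cos_diff)

lemma norm_unit_vec [simp]: "norm (unit_vec t) = 1"
  by (simp add: norm_eq_sqrt_inner inner_unit_vec)

lemma unit_vec_nonzero [simp]: "unit_vec t \<noteq> 0"
  using norm_unit_vec[of t] by force

lemma unit_vec_periodic: "unit_vec (t + 2 * pi) = unit_vec t"
  by (simp add: unit_vec_def)

lemma unit_vec_plus_pi: "unit_vec (t + pi) = - unit_vec t"
  by (simp add: unit_vec_def vec_eq_iff forall_2)

lemma unit_vec_plus: "unit_vec (t + s) = cos s *\<^sub>R unit_vec t + sin s *\<^sub>R unit_vec (t + pi / 2)"
  by (simp add: unit_vec_def vec_eq_iff forall_2 cos_add sin_add)

lemma unit_vec_decomp:
  "v = (v \<bullet> unit_vec t) *\<^sub>R unit_vec t + (v \<bullet> unit_vec (t + pi / 2)) *\<^sub>R unit_vec (t + pi / 2)"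
proof -
  have *: "v $ i = (cos t)\<^sup>2 * v $ i + (sin t)\<^sup>2 * v $ i" for i
    by (simp flip: distrib_right)
  show ?thesis
    using *[of 1] *[of 2]
    by (simp add: unit_vec_def vec_eq_iff forall_2 inner_vec_def sum_2 cos_add sin_add
        algebra_simps power2_eq_square)
qed

lemma polar_form: obtains t where "v = norm v *\<^sub>R unit_vec t"
proof (cases "v = 0")
  case False
  then have norm: "norm v \<noteq> 0" by simp
  have "v $ 1 ^ 2 + v $ 2 ^ 2 = norm v ^ 2"
    unfolding power2_norm_eq_inner by (simp add: inner_vec_def sum_2 power2_eq_square)
  then have "(v $ 1 / norm v)\<^sup>2 + (v $ 2 / norm v)\<^sup>2 = 1"
    using norm by (simp add: power_divide flip: add_divide_distrib)
  then obtain t where "v $ 1 / norm v = cos t" "v $ 2 / norm v = sin t"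
    using sincos_total_2pi_le by blast
  then have "v $ 1 = norm v * cos t" "v $ 2 = norm v * sin t"
    using norm by (metis nonzero_mult_div_cancel_left times_divide_eq_right)+
  then have "v = norm v *\<^sub>R unit_vec t"
    unfolding unit_vec_def vec_eq_iff forall_2 by simp
  then show thesis by (rule that)
qed (simp add: that)

text \<open>The window around \<open>m\<close> later lets a comparison of cosines become one of
  angles, cosine being decreasing on [0, pi].\<close>

lemma polar_form_near: obtains t where "v = norm v *\<^sub>R unit_vec t" "\<bar>t - m\<bar> \<le> pi"
proof -
  obtain t where t: "v = norm v *\<^sub>R unit_vec t" by (rule polar_form)
  define k where "k = round ((m - t) / (2 * pi))"
  have "\<bar>(m - t) / (2 * pi) - of_int k\<bar> \<le> 1 / 2"
    unfolding k_def using of_int_round_abs_le by (simp add: abs_minus_commute)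
  then have "\<bar>t + 2 * pi * of_int k - m\<bar> \<le> pi"
    unfolding abs_le_iff by (auto simp: field_simps)
  moreover have "unit_vec (t + 2 * pi * of_int k) = unit_vec t"
    unfolding unit_vec_def cos_add sin_add cos_int_2pin sin_int_2pin by simp
  ultimately show thesis using t that by metis
qed

lemma line_inter_convex_body:
  fixes K :: "'a::euclidean_space set"
  assumes "convex K" "closed K" "P \<in> interior K" "0 < a" "0 < b"
    and A: "P - a *\<^sub>R d \<in> frontier K" and B: "P + b *\<^sub>R d \<in> frontier K"
  shows "range (\<lambda>x. P + x *\<^sub>R d) \<inter> K = closed_segment (P - a *\<^sub>R d) (P + b *\<^sub>R d)"
proof
  \<comment> \<open>A frontier point passed by the ray before a point of \<open>K\<close> would lie
    strictly between that point and the interior point \<open>P\<close>, hence be interior. Used for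
    both \<open>d\<close> and \<open>- d\<close>.\<close>
  have *: "x \<le> b" if "P + x *\<^sub>R d \<in> K" "0 < b" "P + b *\<^sub>R d \<in> frontier K" for x b d
  proof (rule ccontr)
    assume "\<not> x \<le> b"
    then have "b < x" by simp
    have "d \<noteq> 0" using that assms(3) by (auto simp: frontier_def)
    have "P + b *\<^sub>R d \<in> open_segment P (P + x *\<^sub>R d)"
      unfolding in_segment using \<open>b < x\<close> \<open>0 < b\<close> \<open>d \<noteq> 0\<close>
      by (auto intro!: exI[of _ "b / x"] simp: algebra_simps)
    moreover have "open_segment P (P + x *\<^sub>R d) \<subseteq> interior K"
      using assms(1-3) that(1) closure_subset by (intro in_interior_closure_convex_segment) auto
    ultimately show False using that(3) by (auto simp: frontier_def)
  qed
  show "range (\<lambda>x. P + x *\<^sub>R d) \<inter> K \<subseteq> closed_segment (P - a *\<^sub>R d) (P + b *\<^sub>R d)"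
  proof clarify
    fix x assume x: "P + x *\<^sub>R d \<in> K"
    have "x \<le> b" using *[OF x \<open>0 < b\<close> B] .
    moreover have "- x \<le> a" using *[of "- x" "- d" a] x assms(4) A by simp
    moreover define u where "u = (x + a) / (a + b)"
    ultimately have u: "0 \<le> u" "u \<le> 1" "u * (a + b) = x + a"
      using assms(4,5) unfolding u_def by simp_all
    have "(1 - u) *\<^sub>R (P - a *\<^sub>R d) + u *\<^sub>R (P + b *\<^sub>R d) = P + (u * (a + b) - a) *\<^sub>R d"
      by (simp add: algebra_simps)
    then show "P + x *\<^sub>R d \<in> closed_segment (P - a *\<^sub>R d) (P + b *\<^sub>R d)"
      unfolding in_segment using u by (intro exI[of _ u]) simp
  qed
  have "P - a *\<^sub>R d \<in> K" "P + b *\<^sub>R d \<in> K"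
    using A B assms(2) frontier_subset_closed by blast+
  then have "closed_segment (P - a *\<^sub>R d) (P + b *\<^sub>R d) \<subseteq> K"
    using assms(1) by (simp add: closed_segment_subset)
  moreover have "closed_segment (P - a *\<^sub>R d) (P + b *\<^sub>R d) \<subseteq> range (\<lambda>x. P + x *\<^sub>R d)"
  proof
    fix z assume "z \<in> closed_segment (P - a *\<^sub>R d) (P + b *\<^sub>R d)"
    then obtain u where "z = (1 - u) *\<^sub>R (P - a *\<^sub>R d) + u *\<^sub>R (P + b *\<^sub>R d)"
      unfolding in_segment by auto
    then have "z = P + (u * b - (1 - u) * a) *\<^sub>R d" by (simp add: algebra_simps)
    then show "z \<in> range (\<lambda>x. P + x *\<^sub>R d)" by blast
  qed
  ultimately show "closed_segment (P - a *\<^sub>R d) (P + b *\<^sub>R d) \<subseteq> range (\<lambda>x. P + x *\<^sub>R d) \<inter> K"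
    by blast
qed

subsection \<open>Bodies with an equipotential circle\<close>

text \<open>Monotonicity in \<open>p\<close> of the quotient in \<open>cos_ratio_mono\<close>,
  cross-multiplied. Product-to-sum formulas reduce the difference of the sides to
  \<open>sin d * sin q\<close>.\<close>

lemma cos_ratio_less:
  fixes p p' q :: real
  assumes "p < p'" "p' < p + 2 * pi" "0 < q" "q < pi"
  shows "cos ((p - q) / 2) * cos ((p' + q) / 2) < cos ((p' - q) / 2) * cos ((p + q) / 2)"
proof -
  define d where "d = (p' - p) / 2"
  have "sin d > 0" "sin q > 0"
    using assms by (auto simp: d_def intro: sin_gt_zero)
  then have "sin d * sin q > 0" by simp
  moreover have "cos ((p' - q) / 2) * cos ((p + q) / 2) - cos ((p - q) / 2) * cos ((p' + q) / 2)
      = sin d * sin q"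
  proof -
    have "cos ((p' - q) / 2) * cos ((p + q) / 2) = (cos (d - q) + cos ((p + p') / 2)) / 2"
      unfolding cos_times_cos by (simp add: d_def diff_divide_distrib add_divide_distrib add.commute)
    moreover have "cos ((p - q) / 2) * cos ((p' + q) / 2) = (cos (- (d + q)) + cos ((p + p') / 2)) / 2"
      unfolding cos_times_cos by (simp add: d_def diff_divide_distrib add_divide_distrib add.commute)
    ultimately show ?thesis
      by (simp only: cos_minus) (simp add: cos_diff cos_add field_simps)
  qed
  ultimately show ?thesis by linarith
qed

text \<open>The quotient is symmetric in \<open>p\<close> and \<open>q\<close>, so first
  \<open>q\<close> and then \<open>p\<close> can be raised. Times the radius, it is the height above
  the centre, in direction \<open>w\<close>, of the pole with contact angles \<open>w - q\<close>
  and \<open>w + p\<close>.\<close>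

lemma cos_ratio_mono:
  fixes p p' q q' :: real
  assumes "0 < p" "p < p'" "0 < q" "q \<le> q'" "p' + q' < pi"
  shows "cos ((p - q) / 2) / cos ((p + q) / 2) < cos ((p' - q') / 2) / cos ((p' + q') / 2)"
proof -
  have pos: "cos ((p + q) / 2) > 0" "cos ((p + q') / 2) > 0" "cos ((p' + q') / 2) > 0"
    using assms by (auto intro!: cos_gt_zero_pi)
  have "cos ((p - q) / 2) / cos ((p + q) / 2) \<le> cos ((p - q') / 2) / cos ((p + q') / 2)"
  proof (cases "q = q'")
    case False
    then have "cos ((q - p) / 2) * cos ((q' + p) / 2) < cos ((q' - p) / 2) * cos ((q + p) / 2)"
      using assms by (intro cos_ratio_less) auto
    moreover have "cos ((q - p) / 2) = cos ((p - q) / 2)" "cos ((q' - p) / 2) = cos ((p - q') / 2)"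
      by (metis cos_minus minus_diff_eq minus_divide_left)+
    ultimately show ?thesis using pos by (simp add: field_simps)
  qed auto
  also have "\<dots> < cos ((p' - q') / 2) / cos ((p' + q') / 2)"
    using cos_ratio_less[of p p' q'] assms pos by (simp add: field_simps)
  finally show ?thesis .
qed

locale equipotential_body =
  fixes K :: "(real^2) set" and c :: "real^2" and r l :: real
  assumes body: "convex_body K" and c_interior: "c \<in> interior K"
    and r_pos: "r > 0" and sphere_interior: "sphere c r \<subseteq> interior K"
    and chord_product: "P \<in> sphere c r \<Longrightarrow> cuts_in_chord (tangent_line c P) K A B \<Longrightarrow>
      dist A P * dist P B = l"
begin

section \<open>Poles and supporting lines\<close>

lemma K_convex: "convex K" and K_compact: "compact K" and K_closed: "closed K"
  using body by (auto simp: convex_body_def compact_imp_closed)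

definition contact :: "real \<Rightarrow> real^2" where
  "contact t = c + r *\<^sub>R unit_vec t"

text \<open>The point \<open>pole t x\<close> is the intersection of the tangent lines at the contact points with
  angles \<open>t\<close> and \<open>t + 2 * x\<close>.\<close>

definition pole :: "real \<Rightarrow> real \<Rightarrow> real^2" where
  "pole t x = c + (r / cos x) *\<^sub>R unit_vec (t + x)"

lemma contact_interior: "contact t \<in> interior K"
  using sphere_interior r_pos by (auto simp: contact_def dist_norm)

lemma pole_forward:
  "cos x \<noteq> 0 \<Longrightarrow> pole t x = contact t + (r * tan x) *\<^sub>R unit_vec (t + pi / 2)"
  unfolding pole_def contact_def unit_vec_plus[of t x]
  by (simp add: tan_def scaleR_add_right)

text \<open>Both tangents from a point to the circle have the same length, here
  \<open>r * tan x\<close>; this is \<open>pole_forward\<close> seen from the second contact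
  point.\<close>

lemma pole_backward:
  assumes "cos x \<noteq> 0"
  shows "pole t x = contact (t + 2 * x) - (r * tan x) *\<^sub>R unit_vec (t + 2 * x + pi / 2)"
proof -
  have "unit_vec (t + x) = cos x *\<^sub>R unit_vec (t + 2 * x) - sin x *\<^sub>R unit_vec (t + 2 * x + pi / 2)"
    using unit_vec_plus[of "t + 2 * x" "- x"] by (simp add: add.commute)
  with assms show ?thesis
    unfolding pole_def contact_def by (simp add: tan_def scaleR_diff_right)
qed

text \<open>Otherwise the arc seen from \<open>pole s x\<close> would extend the one seen from
  \<open>pole t y\<close>. The outer normal of a supporting line at \<open>pole t y\<close> points
  into the latter arc, and \<open>pole s x\<close> would be farther out in that direction, beyond
  the supporting line.\<close>

lemma pole_frontier_mono:
  assumes x: "0 < x" "x < pi / 2" "pole s x \<in> frontier K"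
    and y: "0 < y" "y < pi / 2" "pole t y \<in> frontier K"
    and "s \<le> t"
  shows "s + 2 * x \<le> t + 2 * y"
proof (rule ccontr)
  assume "\<not> s + 2 * x \<le> t + 2 * y"
  have cos_pos: "cos x > 0" "cos y > 0" using x y by (auto intro: cos_gt_zero)
  have int: "rel_interior K = interior K"
    using c_interior rel_interior_nonempty_interior by blast
  obtain a where "a \<noteq> 0" and a: "\<And>z. z \<in> K \<Longrightarrow> a \<bullet> pole t y \<le> a \<bullet> z"
      "\<And>z. z \<in> interior K \<Longrightarrow> a \<bullet> pole t y < a \<bullet> z"
    using supporting_hyperplane_relative_frontier[OF K_convex, of "pole t y"] y(3) K_closed
    unfolding int by (auto simp: frontier_def)
  obtain w where w: "- a = norm (- a) *\<^sub>R unit_vec w" "\<bar>w - (t + y)\<bar> \<le> pi"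
    by (rule polar_form_near)
  have aw: "a \<bullet> z = - norm a * (unit_vec w \<bullet> z)" for z
    using w(1) by (metis inner_minus_left inner_scaleR_left minus_minus mult_minus_left norm_minus_cancel)
  have le: "unit_vec w \<bullet> z \<le> unit_vec w \<bullet> pole t y" if "z \<in> K" for z
    using a(1)[OF that] \<open>a \<noteq> 0\<close> unfolding aw by simp
  have less: "unit_vec w \<bullet> z < unit_vec w \<bullet> pole t y" if "z \<in> interior K" for z
    using a(2)[OF that] \<open>a \<noteq> 0\<close> unfolding aw by simp
  have inner_pole: "unit_vec w \<bullet> pole u v = unit_vec w \<bullet> c + r * (cos (u + v - w) / cos v)" for u v
    using cos_minus[of "u + v - w"] by (simp add: pole_def inner_add_right inner_unit_vec)
  \<comment> \<open>The point of the circle in direction \<open>w\<close> is interior, hence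
    strictly inside the supporting line; this puts \<open>w\<close> strictly between
    \<open>t\<close> and \<open>t + 2 * y\<close>.\<close>
  have "r * 1 < r * (cos (t + y - w) / cos y)"
    using less[OF contact_interior[of w]] unfolding inner_pole
    by (simp add: contact_def inner_add_right inner_unit_vec)
  then have "cos y < cos \<bar>t + y - w\<bar>"
    using r_pos cos_pos by (simp only: mult_less_cancel_left_pos) (simp add: field_simps)
  then have "\<bar>t + y - w\<bar> < y"
    using w(2) y cos_mono_less_eq[of y "\<bar>t + y - w\<bar>"] by auto
  \<comment> \<open>The arguments are the angular gaps from \<open>w\<close> forward and backward to
    the two contact angles of each pole; those for \<open>s\<close> add up to
    \<open>2 * x < pi\<close>.\<close>
  then have "cos ((t + 2 * y - w - (w - t)) / 2) / cos ((t + 2 * y - w + (w - t)) / 2)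
      < cos ((s + 2 * x - w - (w - s)) / 2) / cos ((s + 2 * x - w + (w - s)) / 2)"
    using \<open>\<not> s + 2 * x \<le> t + 2 * y\<close> \<open>s \<le> t\<close> x by (intro cos_ratio_mono) auto
  moreover have "(u + 2 * v - w - (w - u)) / 2 = u + v - w" "(u + 2 * v - w + (w - u)) / 2 = v"
    for u v by (simp_all add: field_simps)
  ultimately have "cos (t + y - w) / cos y < cos (s + x - w) / cos x" by (simp only:)
  moreover have "r * (cos (s + x - w) / cos x) \<le> r * (cos (t + y - w) / cos y)"
    using le[of "pole s x"] x(3) frontier_subset_closed[OF K_closed] unfolding inner_pole by auto
  ultimately show False using r_pos by (simp only: mult_le_cancel_left_pos)
qed

text \<open>Existence comes from following the tangent ray to the frontier, uniqueness
  (\<open>h_unique\<close>) from \<open>pole_frontier_mono\<close> with equal contact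
  angles.\<close>

definition h :: "real \<Rightarrow> real" where
  "h t = (SOME x. 0 < x \<and> x < pi / 2 \<and> pole t x \<in> frontier K)"

lemma h: "0 < h t" "h t < pi / 2" "pole t (h t) \<in> frontier K"
proof -
  obtain d where d: "0 < d" "contact t + d *\<^sub>R unit_vec (t + pi / 2) \<in> frontier K"
    using ray_to_frontier[OF compact_imp_bounded[OF K_compact] contact_interior unit_vec_nonzero]
    by metis
  have "arctan (d / r) < pi / 2" "0 < arctan (d / r)" "r * tan (arctan (d / r)) = d"
    using r_pos d(1) arctan_ubound[of "d / r"] by (auto simp: tan_arctan)
  then have "\<exists>x. 0 < x \<and> x < pi / 2 \<and> pole t x \<in> frontier K"
    using d(2) pole_forward[of "arctan (d / r)" t] cos_arctan_not_zero by metis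
  from someI_ex[OF this] show "0 < h t" "h t < pi / 2" "pole t (h t) \<in> frontier K"
    unfolding h_def by blast+
qed

lemma h_unique: "0 < x \<Longrightarrow> x < pi / 2 \<Longrightarrow> pole t x \<in> frontier K \<Longrightarrow> x = h t"
  using pole_frontier_mono[of x t "h t" t] pole_frontier_mono[of "h t" t x t] h[of t] by simp

lemma cos_h: "cos (h t) > 0"
  using h by (intro cos_gt_zero)

section \<open>Tangent chords and the step equation\<close>

lemma tangent_line_contact:
  "tangent_line c (contact t) = range (\<lambda>x. contact t + x *\<^sub>R unit_vec (t + pi / 2))"
proof -
  have perp: "unit_vec (t + pi / 2) \<bullet> unit_vec t = 0" by (simp add: inner_unit_vec)
  have *: "z \<in> tangent_line c (contact t) \<longleftrightarrow> (z - contact t) \<bullet> unit_vec t = 0" for z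
    using r_pos by (simp add: tangent_line_def contact_def)
  show ?thesis
  proof (intro set_eqI iffI)
    fix z assume "z \<in> tangent_line c (contact t)"
    then have "z = contact t + ((z - contact t) \<bullet> unit_vec (t + pi / 2)) *\<^sub>R unit_vec (t + pi / 2)"
      using unit_vec_decomp[of "z - contact t" t] unfolding * by (simp add: algebra_simps)
    then show "z \<in> range (\<lambda>x. contact t + x *\<^sub>R unit_vec (t + pi / 2))" by blast
  qed (auto simp: * perp)
qed

text \<open>A pole lies on the tangents at both of its contact angles, so the forward end reached
  from \<open>t\<close> is the backward end of the chord touching at
  \<open>t + 2 * h t\<close>.\<close>

lemma cuts_in_chord_step:
  "cuts_in_chord (tangent_line c (contact (t + 2 * h t))) K
    (pole t (h t)) (pole (t + 2 * h t) (h (t + 2 * h t)))"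
proof -
  define u where "u = t + 2 * h t"
  let ?d = "unit_vec (u + pi / 2)"
  let ?a = "r * tan (h t)" and ?b = "r * tan (h u)"
  have ab: "0 < ?a" "0 < ?b" using r_pos h by (simp_all add: tan_gt_zero)
  have A: "pole t (h t) = contact u - ?a *\<^sub>R ?d" and B: "pole u (h u) = contact u + ?b *\<^sub>R ?d"
    using pole_backward[of "h t" t] pole_forward[of "h u" u] cos_h[of t] cos_h[of u]
    by (simp_all add: u_def)
  have "pole u (h u) - pole t (h t) = (?a + ?b) *\<^sub>R ?d"
    unfolding A B by (simp add: algebra_simps)
  then have "pole t (h t) \<noteq> pole u (h u)"
    using ab by (metis add_pos_pos diff_self less_irrefl scaleR_eq_0_iff unit_vec_nonzero)
  moreover have "tangent_line c (contact u) \<inter> K = closed_segment (pole t (h t)) (pole u (h u))"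
    unfolding tangent_line_contact A B
    using line_inter_convex_body[OF K_convex K_closed contact_interior ab] h(3)[of t] h(3)[of u]
    unfolding A B .
  ultimately show ?thesis
    using h(3) unfolding cuts_in_chord_def chord_def u_def by blast
qed

lemma contact_sphere: "contact t \<in> sphere c r"
  using r_pos by (simp add: contact_def dist_norm)

lemma tan_product: "tan (h t) * tan (h (t + 2 * h t)) = l / r\<^sup>2"
proof -
  define u where "u = t + 2 * h t"
  have tan: "tan (h t) > 0" for t using h by (simp add: tan_gt_zero)
  have "dist (pole t (h t)) (contact u) = r * tan (h t)"
    using pole_backward[of "h t" t] cos_h[of t] r_pos tan[of t] by (simp add: u_def dist_norm)
  moreover have "dist (contact u) (pole u (h u)) = r * tan (h u)"
    using pole_forward[of "h u" u] cos_h[of u] r_pos tan[of u] by (simp add: dist_norm)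
  ultimately have "(r * tan (h t)) * (r * tan (h u)) = l"
    using chord_product[OF contact_sphere cuts_in_chord_step[of t]] by (simp add: u_def)
  then show ?thesis using r_pos by (simp add: u_def field_simps power2_eq_square)
qed

lemma pole_periodic: "pole (t + 2 * pi) = pole t"
  using unit_vec_periodic[of "t + x" for x] by (simp add: pole_def fun_eq_iff algebra_simps)

sublocale tangent_dynamics h "l / r\<^sup>2"
proof
  \<comment> \<open>The choice made in \<open>h t\<close> depends on \<open>t\<close> only through
    the function \<open>pole t\<close>.\<close>
  show "h (t + 2 * pi) = h t" for t by (simp only: h_def pole_periodic)
  show "s + 2 * h s \<le> t + 2 * h t" if "s \<le> t" for s t
    using that h by (intro pole_frontier_mono)
qed (use h tan_product in auto)

text \<open>A frontier point lies outside the circle, hence ahead of the contact point on one of its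
  two tangents; \<open>h_unique\<close> then identifies the parameter.\<close>

lemma frontier_pole:
  assumes "X \<in> frontier K" obtains t where "X = pole t (h t)"
proof -
  define \<rho> where "\<rho> = norm (X - c)"
  obtain m where "X - c = \<rho> *\<^sub>R unit_vec m" unfolding \<rho>_def by (rule polar_form)
  then have X: "X = c + \<rho> *\<^sub>R unit_vec m" by (simp add: algebra_simps)
  have "r < \<rho>"
  proof (rule ccontr)
    assume "\<not> r < \<rho>"
    then have "X \<in> closed_segment c (contact m)"
      unfolding in_segment X contact_def using r_pos
      by (intro exI[of _ "\<rho> / r"]) (auto simp: \<rho>_def algebra_simps)
    then have "X \<in> interior K"
      using closed_segment_subset[OF c_interior contact_interior convex_interior[OF K_convex]] by blast
    with assms show False by (simp add: frontier_def)
  qed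
  \<comment> \<open>The angle at the centre of the right triangle formed by \<open>c\<close>, the
    contact point and \<open>X\<close>.\<close>
  define x where "x = arccos (r / \<rho>)"
  have bounds: "- 1 \<le> r / \<rho>" "0 < r / \<rho>" "r / \<rho> < 1"
    using r_pos \<open>r < \<rho>\<close> by (auto intro: order_trans[of _ 0])
  then have cos: "cos x = r / \<rho>" unfolding x_def by (intro cos_arccos) auto
  have "0 < x" "x < pi / 2"
    using arccos_less_arccos[of "r / \<rho>" 1] arccos_less_arccos[of 0 "r / \<rho>"] bounds
    by (simp_all add: x_def)
  moreover have "X = pole (m - x) x"
    using r_pos \<open>r < \<rho>\<close> by (simp add: pole_def X cos)
  ultimately have "X = pole (m - x) (h (m - x))"
    using assms h_unique by metis
  then show thesis by (rule that)
qed

section \<open>Symmetry and roundness of the body\<close>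

lemma convex_hull_frontier: "convex hull frontier K = K"
  using Krein_Milman_frontier[OF K_convex K_compact] by simp

text \<open>The reflection sends the pole at \<open>t\<close> to the pole at \<open>t + pi\<close>,
  so it preserves the frontier. Being affine, it then preserves the convex hull, which is
  \<open>K\<close>.\<close>

lemma centrally_symmetric_if:
  assumes "\<And>t. h (t + pi) = h t" shows "centrally_symmetric K c"
proof -
  let ?R = "\<lambda>x. 2 *\<^sub>R c - x"
  have *: "?R X \<in> frontier K" if "X \<in> frontier K" for X
  proof -
    from that obtain t where X: "X = pole t (h t)" by (rule frontier_pole)
    have "unit_vec (t + pi + h t) = - unit_vec (t + h t)"
      using unit_vec_plus_pi[of "t + h t"] by (simp add: add_ac)
    then have "?R X = pole (t + pi) (h (t + pi))"
      unfolding X pole_def assms by (simp add: scaleR_2)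
    then show ?thesis using h(3) by metis
  qed
  have "?R ` frontier K = frontier K"
  proof
    show "frontier K \<subseteq> ?R ` frontier K"
    proof
      fix X assume "X \<in> frontier K"
      then show "X \<in> ?R ` frontier K" by (intro image_eqI[of _ _ "?R X"] *) auto
    qed
  qed (use * in blast)
  then have "?R ` (convex hull frontier K) = convex hull frontier K"
    using convex_hull_affinity[of "2 *\<^sub>R c" "-1" "frontier K"] by simp
  then show ?thesis by (simp add: centrally_symmetric_def convex_hull_frontier)
qed

lemma disc_if:
  assumes "\<And>s t. h s = h t" shows "disc K"
proof -
  define R where "R = r / cos (h 0)"
  have "R > 0" using r_pos cos_h by (simp add: R_def)
  have pole: "pole t (h t) = c + R *\<^sub>R unit_vec (t + h 0)" for t
    using assms[of t 0] by (simp add: pole_def R_def)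
  have "frontier K = sphere c R"
  proof
    show "frontier K \<subseteq> sphere c R"
      using \<open>R > 0\<close> by (auto elim!: frontier_pole simp: pole dist_norm)
    show "sphere c R \<subseteq> frontier K"
    proof
      fix X assume "X \<in> sphere c R"
      then have "norm (X - c) = R" by (simp add: dist_norm norm_minus_commute)
      moreover obtain m where "X - c = norm (X - c) *\<^sub>R unit_vec m" by (rule polar_form)
      ultimately have "X = pole (m - h 0) (h (m - h 0))" by (simp add: pole algebra_simps)
      then show "X \<in> frontier K" using h(3) by metis
    qed
  qed
  also have "\<dots> = frontier (cball c R)" by simp
  finally have "K = cball c R"
    using convex_hull_frontier Krein_Milman_frontier[of "cball c R"] by simp
  with \<open>R > 0\<close> show ?thesis unfolding disc_def by blast
qed

lemma centrally_symmetric_body: "centrally_symmetric K c"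
proof (cases "l / r\<^sup>2 = 1")
  case True
  then show ?thesis by (intro centrally_symmetric_if h_plus_pi)
next
  case False
  then show ?thesis by (intro centrally_symmetric_if h_const)
qed

text \<open>When \<open>l / r\<^sup>2 = 1\<close>, the angle \<open>H 0\<close> is right, and the
  chord touching at \<open>S 0\<close> is the witness.\<close>

lemma disc_or_right_angle: "disc K \<or> (\<exists>A B. tangent_chord K c r A B \<and> angle A c B = pi / 2)"
proof (cases "l / r\<^sup>2 = 1")
  case True
  define u where "u = 0 + 2 * h 0"
  have "h 0 + h u = pi / 2" using H_eq_half_pi[OF True, of 0] by (simp add: S_def u_def)
  then have "0 + h 0 - (u + h u) = - (pi / 2)" by (simp add: u_def)
  then have "cos (0 + h 0 - (u + h u)) = 0" by (simp only: cos_minus cos_pi_half)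
  then have "angle (pole 0 (h 0)) c (pole u (h u)) = pi / 2"
    by (simp add: angle_def pole_def inner_unit_vec)
  moreover have "tangent_chord K c r (pole 0 (h 0)) (pole u (h u))"
    unfolding tangent_chord_def using cuts_in_chord_step[of 0] contact_sphere unfolding u_def by blast
  ultimately show ?thesis by blast
next
  case False
  then show ?thesis by (intro disjI1 disc_if h_const)
qed

end

theorem theorem1:
  fixes K :: "(real^2) set" and c :: "real^2" and r :: real
  assumes "convex_body K"
    and "c \<in> interior K"
    and "equipotential_circle K c r"
  shows "centrally_symmetric K c \<and>
         ((\<forall>A B. tangent_chord K c r A B \<longrightarrow> angle A c B \<noteq> pi / 2) \<longrightarrow> disc K)"
proof -
  obtain l where "\<forall>P\<in>sphere c r. \<forall>A B. cuts_in_chord (tangent_line c P) K A B \<longrightarrow>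
      dist A P * dist P B = l" "r > 0" "sphere c r \<subseteq> interior K"
    using assms(3) unfolding equipotential_circle_def by blast
  then interpret equipotential_body K c r l
    using assms(1,2) by unfold_locales auto
  show ?thesis
    using centrally_symmetric_body disc_or_right_angle by blast
qed

end
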